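(* Let $\mathcal{A}$ be a unital Banach algebra over $\mathbb{C}$ such that, for every $\mathcal{A}$-bimodule $\mathcal{N}$, every Jordan derivation from $\mathcal{A}$ into $\mathcal{N}$ is a derivation. Let $\mathcal{M}$ be a unital $\mathcal{A}$-bimodule and let $n\geq 3$. Then every 2-local derivation $\Delta$ from $M_n(\mathcal{A})$ into $M_n(\mathcal{M})$ is a derivation.
   Context: Let $\mathcal{B}$ be an associative algebra over $\mathbb{C}$ and $\mathcal{N}$ a $\mathcal{B}$-bimodule. A linear map $D:\mathcal{B}\to\mathcal{N}$ is a derivation if $D(xy)=D(x)y+xD(y)$ for all $x,y\in\mathcal{B}$, and a Jordan derivation if $D(x^2)=D(x)x+xD(x)$ for all $x\in\mathcal{B}$ (no continuity is assumed). A map $\Delta:\mathcal{B}\to\mathcal{N}$, not assumed linear, is a 2-local derivation if for every $x,y\in\mathcal{B}$ there is a derivation $D_{x,y}:\mathcal{B}\to\mathcal{N}$ with $D_{x,y}(x)=\Delta(x)$ and $D_{x,y}(y)=\Delta(y)$. An $\mathcal{A}$-bimodule $\mathcal{M}$ is unital if $\mathbf{1}m=m\mathbf{1}=m$ for all $m\in\mathcal{M}$, where $\mathbf{1}$ is the unit of $\mathcal{A}$. $M_n(\mathcal{A})$ is the algebra of $n\times n$ matrices over $\mathcal{A}$, and $M_n(\mathcal{M})$ is the space of $n\times n$ matrices with entries in $\mathcal{M}$, an $M_n(\mathcal{A})$-bimodule via matrix multiplication. *)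

theory Defs
  imports "HOL-Analysis.Analysis" "HOL-Algebra.Module"
begin

class scaleC =
  fixes scaleC :: "complex \<Rightarrow> 'a \<Rightarrow> 'a"  (infixr \<open>*\<^sub>C\<close> 75)

class complex_vector = scaleC + ab_group_add +
  assumes scaleC_add_right: "c *\<^sub>C (x + y) = c *\<^sub>C x + c *\<^sub>C y"
    and scaleC_add_left: "(c + d) *\<^sub>C x = c *\<^sub>C x + d *\<^sub>C x"
    and scaleC_scaleC: "c *\<^sub>C d *\<^sub>C x = (c * d) *\<^sub>C x"
    and scaleC_one: "1 *\<^sub>C x = x"

text \<open>The unit of \<^class>\<open>ring_1\<close> satisfies \<open>1 \<noteq> 0\<close>; \<open>norm 1 = 1\<close> is not required.\<close>

class unital_complex_banach_algebra =
  complex_vector + real_normed_algebra + ring_1 + banach +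
  assumes scaleR_scaleC: "r *\<^sub>R x = complex_of_real r *\<^sub>C x"
    and mult_scaleC_left: "(c *\<^sub>C x) * y = c *\<^sub>C (x * y)"
    and mult_scaleC_right: "x * (c *\<^sub>C y) = c *\<^sub>C (x * y)"
    and norm_scaleC: "norm (c *\<^sub>C x) = cmod c * norm x"

instantiation vec :: (complex_vector, finite) complex_vector
begin

definition scaleC_vec :: "complex \<Rightarrow> 'a ^ 'b \<Rightarrow> 'a ^ 'b" where
  "scaleC_vec c X = (\<chi> i. c *\<^sub>C (X $ i))"

instance
  by standard
    (simp_all add: scaleC_vec_def vec_eq_iff scaleC_add_right scaleC_add_left
      scaleC_scaleC scaleC_one)

end

definition complex_ring :: "complex ring" where
  "complex_ring = \<lparr>carrier = UNIV, mult = (*), one = 1, zero = 0, add = (+)\<rparr>"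

lemma cring_complex_ring: "cring complex_ring"
proof (rule cringI)
  show "abelian_group complex_ring"
    by (rule abelian_groupI)
      (auto simp: complex_ring_def add.assoc add.commute intro: exI[of _ "- x" for x :: complex])
  show "comm_monoid complex_ring"
    by (rule comm_monoidI) (auto simp: complex_ring_def)
qed (auto simp: complex_ring_def algebra_simps)


text \<open>
  A bimodule has its own carrier set and operations, so that one can quantify over bimodules
  inside a formula. The underlying complex vector space is a \<open>module\<close> of HOL-Algebra, whose
  record type also has fields \<open>mult\<close> and \<open>one\<close>; these play no role.

  The algebra acting on it is a type \<open>'b\<close> together with an explicit multiplication \<open>mul\<close>,
  because the multiplication \<open>(*)\<close> that HOL-Analysis provides on \<open>'a ^ 'n ^ 'n\<close> is the
  entrywise one.
\<close>

record ('b, 'm) bimodule = "(complex, 'm) module" +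
  lact :: "'b \<Rightarrow> 'm \<Rightarrow> 'm"
  ract :: "'m \<Rightarrow> 'b \<Rightarrow> 'm"

locale algebra_bimodule = Module.module complex_ring N
  for mul :: "'b::complex_vector \<Rightarrow> 'b \<Rightarrow> 'b" and N :: "('b, 'm) bimodule" (structure) +
  assumes lact_closed: "m \<in> carrier N \<Longrightarrow> lact N a m \<in> carrier N"
    and ract_closed: "m \<in> carrier N \<Longrightarrow> ract N m a \<in> carrier N"
    and lact_add_left: "m \<in> carrier N \<Longrightarrow> lact N (a + b) m = lact N a m \<oplus> lact N b m"
    and lact_add_right:
      "m \<in> carrier N \<Longrightarrow> m' \<in> carrier N \<Longrightarrow> lact N a (m \<oplus> m') = lact N a m \<oplus> lact N a m'"
    and lact_scaleC: "m \<in> carrier N \<Longrightarrow> lact N (c *\<^sub>C a) m = c \<odot> lact N a m"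
    and lact_smult: "m \<in> carrier N \<Longrightarrow> lact N a (c \<odot> m) = c \<odot> lact N a m"
    and ract_add_right: "m \<in> carrier N \<Longrightarrow> ract N m (a + b) = ract N m a \<oplus> ract N m b"
    and ract_add_left:
      "m \<in> carrier N \<Longrightarrow> m' \<in> carrier N \<Longrightarrow> ract N (m \<oplus> m') a = ract N m a \<oplus> ract N m' a"
    and ract_scaleC: "m \<in> carrier N \<Longrightarrow> ract N m (c *\<^sub>C a) = c \<odot> ract N m a"
    and ract_smult: "m \<in> carrier N \<Longrightarrow> ract N (c \<odot> m) a = c \<odot> ract N m a"
    and lact_lact: "m \<in> carrier N \<Longrightarrow> lact N a (lact N b m) = lact N (mul a b) m"
    and ract_ract: "m \<in> carrier N \<Longrightarrow> ract N (ract N m a) b = ract N m (mul a b)"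
    and lact_ract: "m \<in> carrier N \<Longrightarrow> lact N a (ract N m b) = ract N (lact N a m) b"

definition unital_bimodule ::
  "('b::complex_vector \<Rightarrow> 'b \<Rightarrow> 'b) \<Rightarrow> 'b \<Rightarrow> ('b, 'm) bimodule \<Rightarrow> bool" where
  "unital_bimodule mul e N \<longleftrightarrow> algebra_bimodule mul N \<and>
    (\<forall>m\<in>carrier N. lact N e m = m \<and> ract N m e = m)"


definition linear_into :: "('b::complex_vector, 'm) bimodule \<Rightarrow> ('b \<Rightarrow> 'm) \<Rightarrow> bool" where
  "linear_into N D \<longleftrightarrow> (\<forall>x. D x \<in> carrier N) \<and>
    (\<forall>x y. D (x + y) = D x \<oplus>\<^bsub>N\<^esub> D y) \<and> (\<forall>c x. D (c *\<^sub>C x) = c \<odot>\<^bsub>N\<^esub> D x)"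

definition derivation ::
  "('b::complex_vector \<Rightarrow> 'b \<Rightarrow> 'b) \<Rightarrow> ('b, 'm) bimodule \<Rightarrow> ('b \<Rightarrow> 'm) \<Rightarrow> bool" where
  "derivation mul N D \<longleftrightarrow> linear_into N D \<and>
    (\<forall>x y. D (mul x y) = ract N (D x) y \<oplus>\<^bsub>N\<^esub> lact N x (D y))"

definition jordan_derivation ::
  "('b::complex_vector \<Rightarrow> 'b \<Rightarrow> 'b) \<Rightarrow> ('b, 'm) bimodule \<Rightarrow> ('b \<Rightarrow> 'm) \<Rightarrow> bool" where
  "jordan_derivation mul N D \<longleftrightarrow> linear_into N D \<and>
    (\<forall>x. D (mul x x) = ract N (D x) x \<oplus>\<^bsub>N\<^esub> lact N x (D x))"

definition two_local_derivation ::
  "('b::complex_vector \<Rightarrow> 'b \<Rightarrow> 'b) \<Rightarrow> ('b, 'm) bimodule \<Rightarrow> ('b \<Rightarrow> 'm) \<Rightarrow> bool" where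
  "two_local_derivation mul N \<Delta> \<longleftrightarrow>
    (\<forall>x y. \<exists>D. derivation mul N D \<and> D x = \<Delta> x \<and> D y = \<Delta> y)"


text \<open>The bimodule whose carrier is a whole type; the unused fields are \<open>undefined\<close>.\<close>

definition type_bimodule ::
  "('b \<Rightarrow> 'm \<Rightarrow> 'm) \<Rightarrow> ('m \<Rightarrow> 'b \<Rightarrow> 'm) \<Rightarrow> ('b, 'm::complex_vector) bimodule" where
  "type_bimodule l r =
    \<lparr>carrier = UNIV, mult = undefined, one = undefined, zero = 0, add = (+),
     smult = (*\<^sub>C), lact = l, ract = r\<rparr>"

definition matrix_lact ::
  "('a \<Rightarrow> 'm \<Rightarrow> 'm) \<Rightarrow> 'a ^ 'n ^ 'n \<Rightarrow> 'm ^ 'n ^ 'n \<Rightarrow> ('m::ab_group_add) ^ 'n ^ 'n" where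
  "matrix_lact l A X = (\<chi> i j. \<Sum>k\<in>UNIV. l (A $ i $ k) (X $ k $ j))"

definition matrix_ract ::
  "('m \<Rightarrow> 'a \<Rightarrow> 'm) \<Rightarrow> 'm ^ 'n ^ 'n \<Rightarrow> 'a ^ 'n ^ 'n \<Rightarrow> ('m::ab_group_add) ^ 'n ^ 'n" where
  "matrix_ract r X A = (\<chi> i j. \<Sum>k\<in>UNIV. r (X $ i $ k) (A $ k $ j))"

definition matrix_bimodule ::
  "('a \<Rightarrow> 'm \<Rightarrow> 'm) \<Rightarrow> ('m \<Rightarrow> 'a \<Rightarrow> 'm) \<Rightarrow> ('a ^ 'n ^ 'n, 'm::complex_vector ^ 'n ^ 'n) bimodule"
  where "matrix_bimodule l r = type_bimodule (matrix_lact l) (matrix_ract r)"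


lemma algebra_bimodule_type_bimodule_iff:
  fixes l :: "'b::complex_vector \<Rightarrow> 'm::complex_vector \<Rightarrow> 'm"
  shows "algebra_bimodule mul (type_bimodule l r) \<longleftrightarrow>
    (\<forall>m a b. l (a + b) m = l a m + l b m) \<and> (\<forall>m m' a. l a (m + m') = l a m + l a m') \<and>
    (\<forall>m c a. l (c *\<^sub>C a) m = c *\<^sub>C l a m) \<and> (\<forall>m a c. l a (c *\<^sub>C m) = c *\<^sub>C l a m) \<and>
    (\<forall>m a b. r m (a + b) = r m a + r m b) \<and> (\<forall>m m' a. r (m + m') a = r m a + r m' a) \<and>
    (\<forall>m c a. r m (c *\<^sub>C a) = c *\<^sub>C r m a) \<and> (\<forall>m c a. r (c *\<^sub>C m) a = c *\<^sub>C r m a) \<and>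
    (\<forall>m a b. l a (l b m) = l (mul a b) m) \<and> (\<forall>m a b. r (r m a) b = r m (mul a b)) \<and>
    (\<forall>m a b. l a (r m b) = r (l a m) b)"
proof -
  have "abelian_group (type_bimodule l r)"
    by (rule abelian_groupI)
      (auto simp: type_bimodule_def add.assoc add.commute intro: exI[of _ "- x" for x :: 'm])
  then have "Module.module complex_ring (type_bimodule l r)"
    by (intro moduleI cring_complex_ring)
      (simp_all add: complex_ring_def type_bimodule_def
        scaleC_add_left scaleC_add_right scaleC_scaleC scaleC_one)
  then show ?thesis
    unfolding algebra_bimodule_def algebra_bimodule_axioms_def
    by (simp add: type_bimodule_def)
qed

lemma scaleC_sum: "c *\<^sub>C (\<Sum>k\<in>K. f k) = (\<Sum>k\<in>K. c *\<^sub>C (f k :: 'm::complex_vector))"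
proof -
  interpret additive "\<lambda>x::'m. c *\<^sub>C x"
    by standard (rule scaleC_add_right)
  show ?thesis by (rule sum)
qed

lemma algebra_bimodule_matrix_bimodule:
  fixes l :: "'a::unital_complex_banach_algebra \<Rightarrow> 'm::complex_vector \<Rightarrow> 'm"
  assumes "algebra_bimodule (*) (type_bimodule l r)"
  shows "algebra_bimodule (**) (matrix_bimodule l r ::
    ('a ^ 'n ^ 'n, 'm ^ 'n ^ 'n) bimodule)"
proof -
  note B = assms[unfolded algebra_bimodule_type_bimodule_iff]
  interpret la: additive "\<lambda>m. l a m" for a by standard (simp add: B)
  interpret lb: additive "\<lambda>a. l a m" for m by standard (simp add: B)
  interpret ra: additive "\<lambda>m. r m a" for a by standard (simp add: B)
  interpret rb: additive "\<lambda>a. r m a" for m by standard (simp add: B)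
  show ?thesis
    unfolding matrix_bimodule_def algebra_bimodule_type_bimodule_iff
    by (intro conjI allI;
        simp add: vec_eq_iff matrix_lact_def matrix_ract_def matrix_matrix_mult_def
          scaleC_vec_def la.add lb.add ra.add rb.add sum.distrib B scaleC_sum
          la.sum lb.sum ra.sum rb.sum;
        intro allI sum.swap)
qed


text \<open>
  HOL cannot quantify over all types inside a formula. To express that every Jordan derivation of
  an algebra \<open>'a\<close> into every bimodule is a derivation, it suffices to consider bimodules whose
  carrier is a subset of the type \<open>'a\<close> itself, with arbitrary operations. Indeed, a
  Jordan derivation maps into the sub-bimodule generated by its range, which has
  cardinality at most that of \<open>'a\<close>, and so can be transported to a subset of \<open>'a\<close>.
\<close>

lemma ex_inj_list:
  assumes "infinite (UNIV :: 'a set)"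
  shows "\<exists>e :: ('a option \<times> 'a \<times> 'a option) list \<Rightarrow> 'a. inj e"
proof -
  obtain p :: "'a \<times> 'a \<Rightarrow> 'a" where p: "inj p"
    using card_of_Times_same_infinite[OF assms, THEN card_of_ordIso[THEN iffD2]]
    by (auto simp: bij_betw_def)
  obtain nt :: "nat \<Rightarrow> 'a" where nt: "inj nt"
    using infinite_countable_subset[OF assms] by blast
  define q where "q a b = p (a, b)" for a b
  have q: "q a b = q a' b' \<longleftrightarrow> a = a' \<and> b = b'" for a b a' b'
    unfolding q_def by (simp add: inj_eq[OF p])
  define op where "op u = (case u of None \<Rightarrow> q (nt 0) (nt 0) | Some a \<Rightarrow> q (nt 1) a)" for u
  have op: "op u = op v \<longleftrightarrow> u = v" for u v
    by (auto simp: op_def q inj_eq[OF nt] split: option.splits)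
  define tr where "tr t = (case t of (u, a, v) \<Rightarrow> q (op u) (q a (op v)))" for t
  have tr: "tr s = tr t \<longleftrightarrow> s = t" for s t
    by (auto simp: tr_def q op split: prod.splits)
  define en where "en = foldr (\<lambda>t. q (tr t))"
  have en: "length xs = length ys \<Longrightarrow> en xs z = en ys z \<Longrightarrow> xs = ys" for xs ys z
    by (induction xs ys rule: list_induct2) (simp_all add: en_def q tr)
  have "inj (\<lambda>xs. q (nt (length xs)) (en xs (nt 0)))"
    using en by (intro injI) (simp add: q inj_eq[OF nt], blast)
  then show ?thesis by blast
qed

lemma infinite_unital_complex_banach_algebra:
  "infinite (UNIV :: 'a::unital_complex_banach_algebra set)"
proof
  assume "finite (UNIV :: 'a set)"
  moreover have "inj (\<lambda>n. of_nat n *\<^sub>R (1 :: 'a))"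
    by (auto simp: inj_def)
  ultimately show False
    using range_inj_infinite rev_finite_subset subset_UNIV by metis
qed

theorem jordan_derivation_hypothesis_transfer:
  fixes N :: "('a::unital_complex_banach_algebra, 'm) bimodule"
  assumes hyp: "\<And>(N :: ('a, 'a) bimodule) D.
      algebra_bimodule (*) N \<Longrightarrow> jordan_derivation (*) N D \<Longrightarrow> derivation (*) N D"
    and N: "algebra_bimodule (*) N" and D: "jordan_derivation (*) N D"
  shows "derivation (*) N D"
proof -
  interpret N: algebra_bimodule "(*)" N by (rule N)
  have lin: "D x \<in> carrier N" "D (x + y) = D x \<oplus>\<^bsub>N\<^esub> D y" "D (c *\<^sub>C x) = c \<odot>\<^bsub>N\<^esub> D x"
    and jor: "D (x * x) = ract N (D x) x \<oplus>\<^bsub>N\<^esub> lact N x (D x)" for x y c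
    using D by (auto simp: jordan_derivation_def linear_into_def)
  have C: "carrier complex_ring = UNIV" by (simp add: complex_ring_def)

  define lo where "lo u m = (case u of None \<Rightarrow> m | Some a \<Rightarrow> lact N a m)"
    for u :: "'a option" and m
  define ro where "ro m u = (case u of None \<Rightarrow> m | Some a \<Rightarrow> ract N m a)"
    for u :: "'a option" and m
  define tm where "tm t = (case t of (u, x, v) \<Rightarrow> lo u (ro (D x) v))"
    for t :: "'a option \<times> 'a \<times> 'a option"
  define ev where "ev ts = foldr (\<lambda>t m. tm t \<oplus>\<^bsub>N\<^esub> m) ts \<zero>\<^bsub>N\<^esub>" for ts
  have ev_simps: "ev [] = \<zero>\<^bsub>N\<^esub>" "ev (t # ts) = tm t \<oplus>\<^bsub>N\<^esub> ev ts" for t ts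
    by (auto simp: ev_def)
  have tmc: "tm t \<in> carrier N" for t
    by (auto simp: tm_def lo_def ro_def lin N.lact_closed N.ract_closed split: prod.split option.split)
  have evc: "ev ts \<in> carrier N" for ts
    by (induction ts) (auto simp: ev_simps tmc)

  define laT where "laT a t = (case t of (u, x, v) \<Rightarrow>
      (Some (case u of None \<Rightarrow> a | Some b \<Rightarrow> a * b), x, v))"
    for a :: 'a and t :: "'a option \<times> 'a \<times> 'a option"
  define raT where "raT a t = (case t of (u, x, v) \<Rightarrow>
      (u, x, Some (case v of None \<Rightarrow> a | Some b \<Rightarrow> b * a)))"
    for a :: 'a and t :: "'a option \<times> 'a \<times> 'a option"
  define scT where "scT c t = (case t of (u, x, v) \<Rightarrow> (u, c *\<^sub>C x, v))"
    for c and t :: "'a option \<times> 'a \<times> 'a option"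
  have laT: "tm (laT a t) = lact N a (tm t)" for a t
    by (auto simp: laT_def tm_def lo_def ro_def lin N.lact_closed N.ract_closed N.lact_lact
        split: prod.split option.split)
  have raT: "tm (raT a t) = ract N (tm t) a" for a t
    by (auto simp: raT_def tm_def lo_def ro_def lin N.lact_closed N.ract_closed N.ract_ract
        N.lact_ract split: prod.split option.split)
  have scT: "tm (scT c t) = c \<odot>\<^bsub>N\<^esub> tm t" for c t
    by (auto simp: scT_def tm_def lo_def ro_def lin N.lact_closed N.ract_closed N.lact_smult
        N.ract_smult split: prod.split option.split)
  have sm0: "c \<odot>\<^bsub>N\<^esub> \<zero>\<^bsub>N\<^esub> = \<zero>\<^bsub>N\<^esub>" for c
    using N.smult_r_null[of c] C by simp
  have cl[simp]: "c \<odot>\<^bsub>N\<^esub> m \<in> carrier N" if "m \<in> carrier N" for c m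
    using that C by simp
  have sm00: "0 \<odot>\<^bsub>N\<^esub> m = \<zero>\<^bsub>N\<^esub>" if "m \<in> carrier N" for m
    using N.smult_l_null[OF that] by (simp add: complex_ring_def)
  have la0: "lact N a \<zero>\<^bsub>N\<^esub> = \<zero>\<^bsub>N\<^esub>" for a
    using N.lact_smult[of "\<zero>\<^bsub>N\<^esub>" a 0] by (simp add: sm00 N.lact_closed)
  have ra0: "ract N \<zero>\<^bsub>N\<^esub> a = \<zero>\<^bsub>N\<^esub>" for a
    using N.ract_smult[of "\<zero>\<^bsub>N\<^esub>" 0 a] by (simp add: sm00 N.ract_closed)
  have evla: "ev (map (laT a) ts) = lact N a (ev ts)" for a ts
    by (induction ts) (auto simp: ev_simps la0 laT N.lact_add_right tmc evc)
  have evra: "ev (map (raT a) ts) = ract N (ev ts) a" for a ts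
    by (induction ts) (auto simp: ev_simps ra0 raT N.ract_add_left tmc evc)
  have evsc: "ev (map (scT c) ts) = c \<odot>\<^bsub>N\<^esub> ev ts" for c ts
    by (induction ts) (auto simp: ev_simps sm0 scT N.smult_r_distr C tmc evc)
  have evapp: "ev (ss @ ts) = ev ss \<oplus>\<^bsub>N\<^esub> ev ts" for ss ts
    by (induction ss) (auto simp: ev_simps tmc evc N.a_assoc)

  define G where "G = range ev"
  have Gc: "m \<in> carrier N" if "m \<in> G" for m using that by (auto simp: G_def evc)
  have G0: "\<zero>\<^bsub>N\<^esub> \<in> G" by (auto simp: G_def simp flip: ev_simps(1))
  have Gadd: "m \<oplus>\<^bsub>N\<^esub> m' \<in> G" if "m \<in> G" "m' \<in> G" for m m'
    using that by (auto simp: G_def simp flip: evapp)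
  have Gsm: "c \<odot>\<^bsub>N\<^esub> m \<in> G" if "m \<in> G" for c m
    using that by (auto simp: G_def simp flip: evsc)
  have Gla: "lact N a m \<in> G" if "m \<in> G" for a m
    using that by (auto simp: G_def simp flip: evla)
  have Gra: "ract N m a \<in> G" if "m \<in> G" for a m
    using that by (auto simp: G_def simp flip: evra)
  have GD: "D x \<in> G" for x
  proof -
    have "ev [(None, x, None)] = D x"
      by (simp add: ev_simps tm_def lo_def ro_def lin)
    then show ?thesis by (auto simp: G_def simp flip: \<open>ev [(None, x, None)] = D x\<close>)
  qed

  obtain e :: "('a option \<times> 'a \<times> 'a option) list \<Rightarrow> 'a" where e: "inj e"
    using ex_inj_list[OF infinite_unital_complex_banach_algebra] by blast
  define h where "h m = e (inv_into UNIV ev m)" for m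
  define g where "g = inv_into G h"
  have "inj_on h G"
    using e by (auto simp: h_def inj_on_def G_def) (metis (no_types, lifting) f_inv_into_f injD rangeI)
  then have gh: "g (h m) = m" if "m \<in> G" for m
    using that by (simp add: g_def)

  define N' :: "('a, 'a) bimodule" where "N' = \<lparr>carrier = h ` G, mult = undefined, one = undefined,
    zero = h \<zero>\<^bsub>N\<^esub>, add = (\<lambda>u v. h (g u \<oplus>\<^bsub>N\<^esub> g v)), smult = (\<lambda>c u. h (c \<odot>\<^bsub>N\<^esub> g u)),
    lact = (\<lambda>a u. h (lact N a (g u))), ract = (\<lambda>u a. h (ract N (g u) a))\<rparr>"
  have N'_simps: "carrier N' = h ` G" "zero N' = h \<zero>\<^bsub>N\<^esub>"
    "add N' = (\<lambda>u v. h (g u \<oplus>\<^bsub>N\<^esub> g v))" "smult N' = (\<lambda>c u. h (c \<odot>\<^bsub>N\<^esub> g u))"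
    "lact N' = (\<lambda>a u. h (lact N a (g u)))" "ract N' = (\<lambda>u a. h (ract N (g u) a))"
    by (simp_all add: N'_def)
  note S = N'_simps gh Gc G0 Gadd Gsm Gla Gra GD
  have inv: "\<exists>y\<in>G. y \<oplus>\<^bsub>N\<^esub> m = \<zero>\<^bsub>N\<^esub>" if "m \<in> G" for m
  proof
    show "(-1) \<odot>\<^bsub>N\<^esub> m \<in> G" using that by (rule Gsm)
    have "(-1) \<odot>\<^bsub>N\<^esub> m \<oplus>\<^bsub>N\<^esub> m = (-1) \<odot>\<^bsub>N\<^esub> m \<oplus>\<^bsub>N\<^esub> 1 \<odot>\<^bsub>N\<^esub> m"
      using N.smult_one[OF Gc[OF that]] by (simp add: complex_ring_def)
    also have "\<dots> = (-1 + 1) \<odot>\<^bsub>N\<^esub> m"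
      using N.smult_l_distr[of "-1" 1 m] Gc[OF that] by (simp add: complex_ring_def)
    finally show "(-1) \<odot>\<^bsub>N\<^esub> m \<oplus>\<^bsub>N\<^esub> m = \<zero>\<^bsub>N\<^esub>" by (simp add: sm00 Gc[OF that])
  qed
  have "Module.module complex_ring N'"
  proof (rule moduleI)
    show "abelian_group N'"
    proof (rule abelian_groupI)
      fix x assume "x \<in> carrier N'"
      then obtain m where m: "m \<in> G" "x = h m" by (auto simp: S)
      from inv[OF m(1)] obtain y where "y \<in> G" "y \<oplus>\<^bsub>N\<^esub> m = \<zero>\<^bsub>N\<^esub>" by blast
      then show "\<exists>y\<in>carrier N'. y \<oplus>\<^bsub>N'\<^esub> x = \<zero>\<^bsub>N'\<^esub>"
        using m by (intro bexI[of _ "h y"]) (auto simp: S)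
    qed (auto simp: S N.a_ac)
    show "\<one>\<^bsub>complex_ring\<^esub> \<odot>\<^bsub>N'\<^esub> x = x" if "x \<in> carrier N'" for x
      using that by (auto simp: S)
  qed (auto simp: S cring_complex_ring C N.smult_l_distr N.smult_r_distr N.smult_assoc1)
  then have N': "algebra_bimodule (*) N'"
  proof (rule algebra_bimodule.intro)
    show "algebra_bimodule_axioms (*) N'"
      by (rule algebra_bimodule_axioms.intro)
        (auto simp: S N.lact_add_left N.lact_add_right N.lact_scaleC N.lact_smult
          N.ract_add_left N.ract_add_right N.ract_scaleC N.ract_smult
          N.lact_lact N.ract_ract N.lact_ract)
  qed
  have "jordan_derivation (*) N' (\<lambda>x. h (D x))"
    by (auto simp: jordan_derivation_def linear_into_def S lin jor)
  from hyp[OF N' this] have "h (D (x * y)) = h (ract N (D x) y \<oplus>\<^bsub>N\<^esub> lact N x (D y))" for x y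
    by (auto simp: derivation_def S)
  then have "D (x * y) = ract N (D x) y \<oplus>\<^bsub>N\<^esub> lact N x (D y)" for x y
    by (metis gh GD Gadd Gla Gra)
  then show ?thesis
    by (simp add: derivation_def linear_into_def lin)
qed

end

theory Submission
  imports Defs
begin

text \<open>
  A 2-local derivation agrees with a derivation at only two matrices at a time, so every step pairs
  \<open>x\<close> with one further matrix that carries all the information needed about \<open>x\<close>.

  Subtracting from \<open>\<Delta>\<close> a derivation that agrees with it at a diagonal matrix with distinct complex
  entries and at the all-ones matrix leaves a 2-local derivation \<open>\<Delta>\<close> that vanishes on these two. It then
  vanishes on the matrix units, because the first matrix confines the value at a unit to the place
  of that unit and the second kills what remains, and hence on all complex matrices of rank one
  (\<open>vanishes_on_units\<close>, \<open>vanishes_on_rank_one\<close>). From then on a relation between \<open>x\<close> and a single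
  complex matrix \<open>s\<close> of rank one, such as \<open>x ** s = 0\<close>, passes from \<open>x\<close> to \<open>\<Delta> x\<close>.

  The central step (\<open>form_determined\<close>) is that for a complex idempotent \<open>e\<close> of rank one the corner
  \<open>e (\<Delta> x) e\<close> depends only on \<open>e x e\<close>. Adding a multiple of the identity to \<open>x\<close> changes no
  derivation value, and in a Banach algebra a large multiple makes \<open>e x e\<close> invertible within
  the corner, with inverse \<open>w\<close> say. Then \<open>w x w = w\<close>, and the Leibniz rule for a derivation that agrees with
  \<open>\<Delta>\<close> at \<open>x\<close> and \<open>w\<close> expresses \<open>e (\<Delta> x) e\<close> through \<open>\<Delta> w\<close>, whereas \<open>w\<close> depends only on
  \<open>e x e\<close>. Suitable choices of \<open>e\<close> show for \<open>i \<noteq> j\<close> that the \<open>(i, j)\<close> entry of \<open>\<Delta> x\<close> is determined by the pair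
  of entries \<open>(i, i)\<close>, \<open>(i, j)\<close> of \<open>x\<close> and also by the pair \<open>(j, j)\<close>, \<open>(i, j)\<close>; hence it depends on
  the \<open>(i, j)\<close> entry of \<open>x\<close> alone.

  Linear relations between columns or between rows of \<open>x\<close> are inherited by \<open>\<Delta> x\<close>, so \<open>\<Delta>\<close> applies
  one map \<open>f\<close> to every entry. A row with the entries \<open>a\<close>, \<open>b\<close>, \<open>a + b\<close> makes \<open>f\<close> additive; this
  takes three columns. Agreement with a derivation at the diagonal matrix of \<open>a\<close> and at its square
  makes \<open>f\<close> a Jordan derivation, hence a derivation by hypothesis, and a derivation applied
  entrywise is a derivation of the matrix algebra.
\<close>

section \<open>Complex scalars and inverses in the algebra\<close>

interpretation scaleC: Modules.module "scaleC :: complex \<Rightarrow> 'v::complex_vector \<Rightarrow> 'v"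
  by standard (simp_all add: scaleC_add_right scaleC_add_left scaleC_scaleC scaleC_one)

lemma scaleC_cancel_nonzero:
  fixes x :: "'v::complex_vector"
  assumes "c *\<^sub>C x = 0" and "c \<noteq> 0"
  shows "x = 0"
proof -
  have "x = (inverse c * c) *\<^sub>C x" using assms(2) by (simp add: scaleC_one)
  also have "\<dots> = 0" using assms(1) by (simp only: scaleC_scaleC[symmetric] scaleC.scale_zero_right)
  finally show ?thesis .
qed

text \<open>
  The Neumann series \<open>\<Sum>k. y ^ k\<close> is the inverse. The norm of \<open>1\<close> is arbitrary here, so that
  \<open>norm (y ^ k) \<le> norm y ^ k\<close> is available only from the first power on.
\<close>

lemma neumann_series_inverse:
  fixes y :: "'a::unital_complex_banach_algebra"
  assumes "norm y < 1"
  shows "\<exists>b. (1 - y) * b = 1 \<and> b * (1 - y) = 1"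
proof -
  have bound: "norm (y ^ Suc k) \<le> norm y ^ Suc k" for k
  proof (induction k)
    case (Suc k)
    have "norm (y ^ Suc (Suc k)) \<le> norm y * norm (y ^ Suc k)"
      using norm_mult_ineq[of y "y ^ Suc k"] by simp
    also have "\<dots> \<le> norm y * norm y ^ Suc k"
      using Suc.IH by (intro mult_left_mono) auto
    finally show ?case by simp
  qed simp
  have "summable (\<lambda>k. norm y ^ Suc k)"
    using assms by (subst summable_Suc_iff) (simp add: summable_geometric)
  then have "summable (\<lambda>k. y ^ Suc k)"
    by (rule summable_comparison_test') (rule bound)
  then have s: "summable (\<lambda>k. y ^ k)"
    by (subst (asm) summable_Suc_iff)
  have head: "(\<Sum>k. y ^ Suc k) = (\<Sum>k. y ^ k) - 1"
    using suminf_split_head[OF s] by simp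
  have "y * (\<Sum>k. y ^ k) = (\<Sum>k. y ^ k) - 1"
    using suminf_mult[OF s, of y] head by simp
  moreover have "(\<Sum>k. y ^ k) * y = (\<Sum>k. y ^ k) - 1"
    using suminf_mult2[OF s, of y] head by (simp add: power_commutes)
  ultimately show ?thesis
    by (intro exI[of _ "\<Sum>k. y ^ k"]) (simp add: algebra_simps)
qed

text \<open>
  With \<open>t = norm a + 1\<close> the element \<open>a + t\<close> is \<open>t (1 + a / t)\<close>, and \<open>a / t\<close> has norm less than
  one.
\<close>

lemma shift_invertible:
  fixes a :: "'a::unital_complex_banach_algebra"
  shows "\<exists>c b. (a + c *\<^sub>C 1) * b = 1 \<and> b * (a + c *\<^sub>C 1) = 1"
proof -
  define t where "t = norm a + 1"
  have t: "t > 0" by (simp add: t_def add_nonneg_pos)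
  have "norm (- inverse t *\<^sub>R a) < 1" using t by (simp add: t_def divide_simps)
  from neumann_series_inverse[OF this] obtain b where
    b: "(1 - (- inverse t *\<^sub>R a)) * b = 1" "b * (1 - (- inverse t *\<^sub>R a)) = 1" by blast
  have eq: "a + complex_of_real t *\<^sub>C 1 = t *\<^sub>R (1 - (- inverse t *\<^sub>R a))"
    using t by (simp add: scaleR_scaleC[symmetric] algebra_simps)
  show ?thesis
    by (rule exI[of _ "complex_of_real t"], rule exI[of _ "inverse t *\<^sub>R b"])
      (use t b in \<open>simp add: eq\<close>)
qed

section \<open>Rank-one matrices\<close>

text \<open>
  This is \<open>a\<close> tensored with the complex matrix of rank one that is the product of the column \<open>v\<close>
  and the row \<open>u\<close>. The coefficient may come from the algebra or from the bimodule.
\<close>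

definition rank_one :: "('n \<Rightarrow> complex) \<Rightarrow> 'v::complex_vector \<Rightarrow> ('n \<Rightarrow> complex) \<Rightarrow> 'v ^ 'n ^ 'n" where
  "rank_one v a u = (\<chi> i j. (v i * u j) *\<^sub>C a)"

text \<open>
  The product of the row \<open>u\<close>, the matrix \<open>x\<close> and the column \<open>v\<close>.
\<close>

definition form :: "('n \<Rightarrow> complex) \<Rightarrow> ('n \<Rightarrow> complex) \<Rightarrow> ('v::complex_vector) ^ 'n ^ 'n \<Rightarrow> 'v" where
  "form u v x = (\<Sum>k\<in>UNIV. \<Sum>q\<in>UNIV. (u k * v q) *\<^sub>C (x $ k $ q))"

definition dirac :: "'n \<Rightarrow> 'n \<Rightarrow> complex" where
  "dirac i = (\<lambda>k. if k = i then 1 else 0)"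

lemma sum_dirac:
  fixes f :: "'n::finite \<Rightarrow> 'v::complex_vector"
  shows "(\<Sum>k\<in>UNIV. dirac i k *\<^sub>C f k) = f i"
proof -
  have "(\<Sum>k\<in>UNIV. dirac i k *\<^sub>C f k) = (\<Sum>k\<in>UNIV. if k = i then f k else 0)"
    by (rule sum.cong) (simp_all add: dirac_def scaleC_one)
  then show ?thesis by simp
qed

lemma sum_two_dirac:
  fixes f :: "'n::finite \<Rightarrow> 'v::complex_vector"
  shows "(\<Sum>k\<in>UNIV. (dirac i k + dirac j k) *\<^sub>C f k) = f i + f j"
  by (simp add: scaleC_add_left sum.distrib sum_dirac)

lemma sum_dirac_complex: "(\<Sum>k\<in>UNIV. dirac i k * f k) = f (i :: 'n::finite)"
proof -
  have "(\<Sum>k\<in>UNIV. dirac i k * f k) = (\<Sum>k\<in>UNIV. if k = i then f k else 0)"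
    by (rule sum.cong) (simp_all add: dirac_def)
  then show ?thesis by simp
qed

lemma form_dirac_left: "form (dirac i) v x = (\<Sum>q\<in>UNIV. v q *\<^sub>C (x $ i $ q))"
  by (simp add: form_def scaleC_scaleC[symmetric] scaleC_sum[symmetric] sum_dirac del: scaleC.scale_scale)

lemma form_dirac_right: "form u (dirac j) x = (\<Sum>k\<in>UNIV. u k *\<^sub>C (x $ k $ j))"
  by (simp add: form_def scaleC_scaleC[symmetric] scaleC_sum[symmetric] sum_dirac del: scaleC.scale_scale)

lemma form_add_scaleC: "form u v (x + c *\<^sub>C y) = form u v x + c *\<^sub>C form u v y"
  by (simp add: form_def scaleC_add_right sum.distrib scaleC_vec_def scaleC_sum mult_ac)

lemma form_mat_one:
  "form u v (mat 1 :: 'a::unital_complex_banach_algebra ^ 'n ^ 'n) = (\<Sum>k\<in>UNIV. u k * v k) *\<^sub>C 1"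
proof -
  have "(\<Sum>q\<in>UNIV. (u k * v q) *\<^sub>C (mat 1 :: 'a ^ 'n ^ 'n) $ k $ q) = (u k * v k) *\<^sub>C 1" for k
  proof -
    have "(\<Sum>q\<in>UNIV. (u k * v q) *\<^sub>C (mat 1 :: 'a ^ 'n ^ 'n) $ k $ q)
        = (\<Sum>q\<in>UNIV. if k = q then (u k * v q) *\<^sub>C 1 else 0)"
      by (rule sum.cong) (auto simp: mat_def)
    then show ?thesis by simp
  qed
  then show ?thesis by (simp add: form_def scaleC.scale_sum_left)
qed

lemma form_dirac: "form (dirac i) (dirac j) x = x $ i $ j"
  by (simp add: form_dirac_left sum_dirac)

lemma sum_scaled_dirac:
  fixes f :: "'n::finite \<Rightarrow> 'v::complex_vector"
  shows "(\<Sum>k\<in>UNIV. (c * dirac i k) *\<^sub>C f k) = c *\<^sub>C f i"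
  by (simp only: scaleC_scaleC[symmetric] scaleC_sum[symmetric] sum_dirac)

lemma rank_one_inj:
  assumes "rank_one v a u = rank_one v b u" and "v i * u j \<noteq> 0"
  shows "a = b"
proof -
  have "(v i * u j) *\<^sub>C (a - b) = 0"
    using assms(1) by (simp add: rank_one_def vec_eq_iff scaleC.scale_right_diff_distrib)
  then show ?thesis using scaleC_cancel_nonzero[OF _ assms(2)] by force
qed

lemma rank_one_mult:
  fixes a b :: "'a::unital_complex_banach_algebra"
  shows "rank_one v a u ** rank_one v' b u' = rank_one v ((\<Sum>k\<in>UNIV. u k * v' k) *\<^sub>C (a * b)) u'"
  by (simp add: vec_eq_iff matrix_matrix_mult_def rank_one_def mult_scaleC_left mult_scaleC_right
      scaleC_scaleC scaleC.scale_sum_left[symmetric] sum_distrib_left mult_ac)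

text \<open>
  A product of this kind sees \<open>x\<close> only through the one coefficient \<open>form u v' x\<close>. This is what
  lets a relation with a rank-one matrix isolate an entry, or a sum of entries, of \<open>x\<close>.
\<close>

lemma rank_one_sandwich:
  fixes x :: "'a::unital_complex_banach_algebra ^ 'n ^ 'n"
  shows "rank_one v 1 u ** x ** rank_one v' 1 u' = rank_one v (form u v' x) u'"
  by (simp add: vec_eq_iff matrix_matrix_mult_def rank_one_def form_def mult_scaleC_left
      mult_scaleC_right scaleC_scaleC scaleC_sum sum_distrib_right mult_ac)
    (intro allI sum.swap)

section \<open>Derivations on the matrix bimodule\<close>

locale unital_coefficient_bimodule =
  fixes l :: "'a::unital_complex_banach_algebra \<Rightarrow> 'm::complex_vector \<Rightarrow> 'm"
    and r :: "'m \<Rightarrow> 'a \<Rightarrow> 'm"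
  assumes unital: "unital_bimodule (*) 1 (type_bimodule l r)"
begin

abbreviation L :: "'a ^ 'n ^ 'n \<Rightarrow> 'm ^ 'n ^ 'n \<Rightarrow> 'm ^ 'n ^ 'n" where
  "L \<equiv> matrix_lact l"

abbreviation R :: "'m ^ 'n ^ 'n \<Rightarrow> 'a ^ 'n ^ 'n \<Rightarrow> 'm ^ 'n ^ 'n" where
  "R \<equiv> matrix_ract r"

lemma coefficient_bimodule: "algebra_bimodule (*) (type_bimodule l r)"
  using unital by (simp add: unital_bimodule_def)

lemmas coefficient_actions = coefficient_bimodule[unfolded algebra_bimodule_type_bimodule_iff]

lemma coefficient_one: "l 1 m = m" "r m 1 = m"
  using unital by (auto simp: unital_bimodule_def type_bimodule_def)

lemmas matrix_actions = algebra_bimodule_matrix_bimodule[OF coefficient_bimodule,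
    unfolded matrix_bimodule_def algebra_bimodule_type_bimodule_iff]

lemma action_assoc:
  fixes a b :: "'a ^ 'n ^ 'n" and m :: "'m ^ 'n ^ 'n"
  shows "L a (L b m) = L (a ** b) m" "R (R m a) b = R m (a ** b)" "L a (R m b) = R (L a m) b"
  using matrix_actions[where 'n = 'n] by auto

lemma action_bilinear:
  fixes a b :: "'a ^ 'n ^ 'n" and m m' :: "'m ^ 'n ^ 'n"
  shows "L (a + b) m = L a m + L b m" "L a (m + m') = L a m + L a m'"
    "R m (a + b) = R m a + R m b" "R (m + m') a = R m a + R m' a"
    "L (c *\<^sub>C a) m = c *\<^sub>C L a m" "L a (c *\<^sub>C m) = c *\<^sub>C L a m"
    "R m (c *\<^sub>C a) = c *\<^sub>C R m a" "R (c *\<^sub>C m) a = c *\<^sub>C R m a"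
  using matrix_actions[where 'n = 'n] by auto

lemma action_diff:
  fixes a :: "'a ^ 'n ^ 'n" and m m' :: "'m ^ 'n ^ 'n"
  shows "L a (m - m') = L a m - L a m'" "R (m - m') a = R m a - R m' a"
  by (metis action_bilinear(2) add_diff_cancel diff_add_cancel)
    (metis action_bilinear(4) add_diff_cancel diff_add_cancel)

lemma action_zero [simp]:
  fixes a :: "'a ^ 'n ^ 'n"
  shows "L a 0 = 0" "R 0 a = 0"
  using action_diff[where m = 0 and m' = 0 and a = a] by simp_all

lemma coefficient_zero: "l 0 m = 0" "r m 0 = 0"
  using coefficient_actions by (metis add_cancel_right_right)+

lemma coefficient_scalar: "l (c *\<^sub>C 1) m = c *\<^sub>C m" "r m (c *\<^sub>C 1) = c *\<^sub>C m"
  using coefficient_actions by (simp_all add: coefficient_one)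

lemma action_one: "L (mat 1) m = m" "R m (mat 1) = m"
proof -
  have 1: "l (if p then 1 else 0) m = (if p then m else 0)"
    "r m (if p then 1 else 0) = (if p then m else 0)" for p m
    by (simp_all add: coefficient_one coefficient_zero)
  show "L (mat 1) m = m" "R m (mat 1) = m"
    by (simp_all add: vec_eq_iff matrix_lact_def matrix_ract_def mat_def 1)
qed

lemma derivation_matrix_iff:
  fixes D :: "'a ^ 'n ^ 'n \<Rightarrow> 'm ^ 'n ^ 'n"
  shows "derivation (**) (matrix_bimodule l r) D \<longleftrightarrow>
    (\<forall>x y. D (x + y) = D x + D y) \<and> (\<forall>c x. D (c *\<^sub>C x) = c *\<^sub>C D x) \<and>
    (\<forall>x y. D (x ** y) = R (D x) y + L x (D y))"
  by (simp add: derivation_def linear_into_def matrix_bimodule_def type_bimodule_def)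

lemma derivation_rules:
  fixes D :: "'a ^ 'n ^ 'n \<Rightarrow> 'm ^ 'n ^ 'n"
  assumes "derivation (**) (matrix_bimodule l r) D"
  shows "D (x + y) = D x + D y" "D (c *\<^sub>C x) = c *\<^sub>C D x" "D (x ** y) = R (D x) y + L x (D y)"
  using assms by (simp_all add: derivation_matrix_iff)

lemma derivation_add:
  fixes D D' :: "'a ^ 'n ^ 'n \<Rightarrow> 'm ^ 'n ^ 'n"
  assumes "derivation (**) (matrix_bimodule l r) D" "derivation (**) (matrix_bimodule l r) D'"
  shows "derivation (**) (matrix_bimodule l r) (\<lambda>x. D x + D' x)"
  using assms by (simp add: derivation_matrix_iff scaleC_add_right action_bilinear)

lemma derivation_diff:
  fixes D D' :: "'a ^ 'n ^ 'n \<Rightarrow> 'm ^ 'n ^ 'n"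
  assumes "derivation (**) (matrix_bimodule l r) D" "derivation (**) (matrix_bimodule l r) D'"
  shows "derivation (**) (matrix_bimodule l r) (\<lambda>x. D x - D' x)"
  using assms by (simp add: derivation_matrix_iff scaleC.scale_right_diff_distrib action_diff)

lemma two_local_derivation_diff:
  fixes \<Delta> D :: "'a ^ 'n ^ 'n \<Rightarrow> 'm ^ 'n ^ 'n"
  assumes "two_local_derivation (**) (matrix_bimodule l r) \<Delta>"
    and "derivation (**) (matrix_bimodule l r) D"
  shows "two_local_derivation (**) (matrix_bimodule l r) (\<lambda>x. \<Delta> x - D x)"
  unfolding two_local_derivation_def
proof (intro allI)
  fix x y
  obtain D' where D': "derivation (**) (matrix_bimodule l r) D'" "D' x = \<Delta> x" "D' y = \<Delta> y"
    using assms(1) by (auto simp: two_local_derivation_def)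
  show "\<exists>E. derivation (**) (matrix_bimodule l r) E \<and> E x = \<Delta> x - D x \<and> E y = \<Delta> y - D y"
    by (rule exI[of _ "\<lambda>z. D' z - D z"]) (simp add: derivation_diff[OF D'(1) assms(2)] D')
qed

lemma derivation_one:
  fixes D :: "'a ^ 'n ^ 'n \<Rightarrow> 'm ^ 'n ^ 'n"
  assumes "derivation (**) (matrix_bimodule l r) D"
  shows "D (mat 1) = 0"
proof -
  have "D (mat 1 ** mat 1) = D (mat 1) + D (mat 1)"
    using assms by (simp only: derivation_matrix_iff action_one)
  then show ?thesis by simp
qed

lemma derivation_sandwich:
  fixes D :: "'a ^ 'n ^ 'n \<Rightarrow> 'm ^ 'n ^ 'n"
  assumes D: "derivation (**) (matrix_bimodule l r) D" and "D e = 0"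
  shows "D (e ** x ** e) = R (L e (D x)) e"
  using assms(2) by (simp add: derivation_rules[OF D])

lemma sandwich_rank_one:
  fixes m :: "'m ^ 'n ^ 'n"
  shows "R (L (rank_one v 1 u) m) (rank_one v' 1 u') = rank_one v (form u v' m) u'"
  by (simp add: vec_eq_iff matrix_lact_def matrix_ract_def rank_one_def form_def coefficient_scalar
      scaleC_sum mult_ac)
    (intro allI sum.swap)

end

section \<open>Two-local derivations that vanish on complex matrices\<close>

locale two_local = unital_coefficient_bimodule l r
  for l :: "'a::unital_complex_banach_algebra \<Rightarrow> 'm::complex_vector \<Rightarrow> 'm"
    and r :: "'m \<Rightarrow> 'a \<Rightarrow> 'm" +
  fixes \<Delta> :: "'a ^ 'n ^ 'n \<Rightarrow> 'm ^ 'n ^ 'n"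
  assumes two_local: "two_local_derivation (**) (matrix_bimodule l r) \<Delta>"
begin

lemma derivation_through:
  obtains D where "derivation (**) (matrix_bimodule l r) D" "D x = \<Delta> x" "D y = \<Delta> y"
  using two_local by (auto simp: two_local_derivation_def)

text \<open>
  Let \<open>m\<close> be the value at the matrix unit \<open>E\<close>, and \<open>d\<close>, \<open>J\<close> the two matrices at which \<open>\<Delta>\<close> is
  assumed to vanish. As \<open>E\<close> is an eigenvector of left and of right multiplication by \<open>d\<close>, so is \<open>m\<close>,
  with the same eigenvalues; as these are distinct, \<open>m\<close> has at most one nonzero entry, in the place
  of the unit. That entry is the coefficient of \<open>J m J\<close>, which vanishes because \<open>J E J = J\<close>.
\<close>

lemma vanishes_on_units:
  fixes t :: "'n \<Rightarrow> complex"
  assumes t: "inj t"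
    and diag: "\<Delta> (\<chi> i j. (if i = j then t i else 0) *\<^sub>C 1) = 0"
    and ones: "\<Delta> (rank_one (\<lambda>_. 1) 1 (\<lambda>_. 1)) = 0"
  shows "\<Delta> (rank_one (dirac i) 1 (dirac j)) = 0"
proof -
  define d :: "'a ^ 'n ^ 'n" where "d = (\<chi> i j. (if i = j then t i else 0) *\<^sub>C 1)"
  define J :: "'a ^ 'n ^ 'n" where "J = rank_one (\<lambda>_. 1) 1 (\<lambda>_. 1)"
  define E :: "'a ^ 'n ^ 'n" where "E = rank_one (dirac i) 1 (dirac j)"
  define m where "m = \<Delta> E"
  have if_scale: "(if p then c else 0) *\<^sub>C x = (if p then c *\<^sub>C x else 0)" for p c and x :: "'z::complex_vector"
    by simp
  have l_if: "l (if p then c *\<^sub>C 1 else 0) x = (if p then c *\<^sub>C x else 0)"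
    and r_if: "r x (if p then c *\<^sub>C 1 else 0) = (if p then c *\<^sub>C x else 0)" for p c x
    by (simp_all add: coefficient_zero coefficient_scalar)
  have ifm: "(if p then x else 0) * y = (if p then x * y else 0)" "y * (if p then x else 0) = (if p then y * x else 0)" for p and x y :: 'a
    by simp_all
  have dx: "(d ** x) $ p $ q = t p *\<^sub>C x $ p $ q" "(x ** d) $ p $ q = t q *\<^sub>C x $ p $ q" for x p q
    unfolding d_def
    by (simp_all add: matrix_matrix_mult_def if_scale ifm mult_scaleC_left mult_scaleC_right)
  have dE: "d ** E = t i *\<^sub>C E" "E ** d = t j *\<^sub>C E"
    by (simp_all add: vec_eq_iff dx scaleC_vec_def) (simp_all add: E_def rank_one_def dirac_def)
  have dm: "L d m $ p $ q = t p *\<^sub>C m $ p $ q" "R m d $ p $ q = t q *\<^sub>C m $ p $ q" for p q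
    unfolding d_def by (simp_all add: matrix_lact_def matrix_ract_def if_scale l_if r_if)
  obtain D where D: "derivation (**) (matrix_bimodule l r) D" "D d = \<Delta> d" "D E = \<Delta> E"
    by (rule derivation_through)
  have "L d m = t i *\<^sub>C m" "R m d = t j *\<^sub>C m"
    using derivation_rules(3)[OF D(1), of d E] derivation_rules(3)[OF D(1), of E d] diag
    by (simp_all add: dE derivation_rules(2)[OF D(1)] D(2,3) m_def d_def[symmetric])
  then have "(t p - t i) *\<^sub>C m $ p $ q = 0" "(t q - t j) *\<^sub>C m $ p $ q = 0" for p q
    using dm[of p q] by (simp_all add: scaleC.scale_left_diff_distrib scaleC_vec_def)
  then have supp: "m $ p $ q = 0" if "p \<noteq> i \<or> q \<noteq> j" for p q
    using that t scaleC_cancel_nonzero by (metis injD right_minus_eq)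
  obtain D where D: "derivation (**) (matrix_bimodule l r) D" "D J = \<Delta> J" "D E = \<Delta> E"
    by (rule derivation_through)
  have "form (\<lambda>_. 1) (\<lambda>_. 1) E = (1 :: 'a)"
    unfolding E_def
    by (simp add: form_def rank_one_def scaleC_one scaleC_scaleC[symmetric] scaleC_sum[symmetric] sum_dirac del: scaleC.scale_scale)
  then have "J ** E ** J = J" unfolding J_def by (simp add: rank_one_sandwich)
  then have "R (L J m) J = 0"
    using derivation_sandwich[OF D(1), of J E] ones by (simp add: D(2,3) J_def[symmetric] m_def)
  then have "rank_one (\<lambda>_. 1) (form (\<lambda>_. 1) (\<lambda>_. 1) m) (\<lambda>_. 1) = (rank_one (\<lambda>_. 1) 0 (\<lambda>_. 1) :: 'm^'n^'n)"
    unfolding J_def sandwich_rank_one by (simp add: rank_one_def vec_eq_iff)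
  then have "form (\<lambda>_. 1) (\<lambda>_. 1) m = 0" by (rule rank_one_inj) simp
  moreover have "form (\<lambda>_. 1) (\<lambda>_. 1) m = m $ i $ j"
  proof -
    have "form (\<lambda>_. 1) (\<lambda>_. 1) m = (\<Sum>p\<in>UNIV. \<Sum>q\<in>UNIV. if p = i then if q = j then m $ p $ q else 0 else 0)"
      unfolding form_def by (intro sum.cong) (auto simp: scaleC_one supp)
    also have "\<dots> = (\<Sum>p\<in>UNIV. if p = i then m $ p $ j else 0)"
      by (intro sum.cong) auto
    finally show ?thesis by simp
  qed
  ultimately have "m = 0" using supp by (metis vec_eq_iff zero_index)
  then show ?thesis by (simp add: m_def E_def)
qed

end

locale normalized_two_local = two_local l r \<Delta>
  for l :: "'a::unital_complex_banach_algebra \<Rightarrow> 'm::complex_vector \<Rightarrow> 'm"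
    and r :: "'m \<Rightarrow> 'a \<Rightarrow> 'm"
    and \<Delta> :: "'a ^ 'n ^ 'n \<Rightarrow> 'm ^ 'n ^ 'n" +
  assumes units: "\<Delta> (rank_one (dirac i) 1 (dirac j)) = 0"
begin

text \<open>
  For a complex matrix \<open>s\<close> and the unit \<open>E\<close> at \<open>(j, i)\<close>, the matrix \<open>E s E\<close> is a complex multiple of
  \<open>E\<close>. A derivation that kills \<open>E\<close> also kills this multiple;
  if it agrees with \<open>\<Delta>\<close> at \<open>s\<close>, the \<open>(i, j)\<close> entry of \<open>\<Delta> s\<close>, as the coefficient of \<open>E (\<Delta> s) E\<close>,
  must vanish.
\<close>

lemma vanishes_on_rank_one: "\<Delta> (rank_one v 1 u) = 0"
proof -
  define s :: "'a ^ 'n ^ 'n" where "s = rank_one v 1 u"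
  have "\<Delta> s $ i $ j = 0" for i j
  proof -
    define E :: "'a ^ 'n ^ 'n" where "E = rank_one (dirac j) 1 (dirac i)"
    obtain D where D: "derivation (**) (matrix_bimodule l r) D" "D s = \<Delta> s" "D E = \<Delta> E"
      by (rule derivation_through)
    have "E ** s ** E = (v i * u j) *\<^sub>C E"
      by (simp add: E_def rank_one_sandwich form_dirac)
        (simp add: s_def rank_one_def vec_eq_iff scaleC_vec_def mult_ac)
    then have "R (L E (\<Delta> s)) E = 0"
      using derivation_sandwich[OF D(1), of E s] units[of j i]
      by (simp add: D(2,3) derivation_rules(2)[OF D(1)] E_def[symmetric])
    then have "rank_one (dirac j) (\<Delta> s $ i $ j) (dirac i) = (rank_one (dirac j) 0 (dirac i) :: 'm^'n^'n)"
      unfolding E_def sandwich_rank_one form_dirac by (simp add: rank_one_def vec_eq_iff)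
    then show ?thesis by (rule rank_one_inj[of _ _ _ _ j i]) (simp add: dirac_def)
  qed
  then show ?thesis by (simp add: vec_eq_iff s_def)
qed

text \<open>
  In the corner of \<open>e\<close> the element \<open>w\<close> is the inverse of \<open>e (x + c) e\<close>, so that
  \<open>w (x + c) w = w\<close>. Apply a derivation that agrees with \<open>\<Delta>\<close> at \<open>x\<close> and \<open>w\<close> to this equation, and
  multiply by the inverse \<open>G\<close> of \<open>w\<close> from both sides: the two outer Leibniz terms and the left-hand
  side all become \<open>G (\<Delta> w) G\<close>. This is the usual rule for the derivative of an inverse, solved for
  the derivative of \<open>x\<close>.
\<close>

lemma corner_formula:
  assumes e: "\<Delta> e = 0" "e ** e = e"
    and w: "e ** w = w" "w ** e = w"
    and G: "G = e ** (x + c *\<^sub>C mat 1) ** e"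
    and inverse: "G ** w = e" "w ** G = e"
  shows "R (L e (\<Delta> x)) e = - R (L G (\<Delta> w)) G"
proof -
  define x' where "x' = x + c *\<^sub>C mat 1"
  define h where "h = \<Delta> w"
  obtain D where D: "derivation (**) (matrix_bimodule l r) D" "D w = \<Delta> w" "D e = \<Delta> e"
    by (rule derivation_through)
  \<comment> \<open>The value at \<open>w\<close> stays in the corner, by a derivation through \<open>w\<close> and \<open>e\<close>.\<close>
  have eh: "L e h = h" using derivation_rules(3)[OF D(1), of e w] by (simp add: D(2,3) e(1) h_def w)
  have he: "R h e = h" using derivation_rules(3)[OF D(1), of w e] by (simp add: D(2,3) e(1) h_def w)
  obtain D where D: "derivation (**) (matrix_bimodule l r) D" "D x = \<Delta> x" "D w = \<Delta> w"
    by (rule derivation_through)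
  have Dx': "D x' = \<Delta> x"
    by (simp add: x'_def D(2) derivation_rules[OF D(1)] derivation_one[OF D(1)])
  have G': "G = e ** x' ** e" by (simp add: G x'_def)
  have "w ** x' ** w = w ** e ** x' ** (e ** w)" by (simp add: w)
  also have "\<dots> = w ** (G ** w)" by (simp add: G' matrix_mul_assoc)
  finally have "w ** x' ** w = w" by (simp add: inverse w)
  then have h: "h = R h (x' ** w) + R (L w (\<Delta> x)) w + L (w ** x') h"
    using derivation_rules(3)[OF D(1), of "w ** x'" w] derivation_rules(3)[OF D(1), of w x']
    by (simp add: D(3) Dx' action_bilinear action_assoc h_def)
  have eG: "e ** G = G" by (simp add: G' matrix_mul_assoc e)
  have 1: "R h (x' ** w ** G) = R h G"
  proof -
    have "R h (x' ** w ** G) = R (R h e) (x' ** (e ** w) ** G)" by (simp add: he w)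
    also have "\<dots> = R h (G ** w ** G)" by (simp only: action_assoc G' matrix_mul_assoc)
    finally show ?thesis by (simp add: inverse eG)
  qed
  have 2: "L (G ** w ** x') h = L G h"
  proof -
    have "L (G ** w ** x') h = L (G ** (w ** e) ** x') (L e h)" by (simp add: eh w)
    also have "\<dots> = L (G ** w ** G) h" by (simp only: action_assoc G' matrix_mul_assoc)
    finally show ?thesis by (simp add: inverse eG)
  qed
  have "R (L G h) G = R (L G (R h (x' ** w ** G))) (mat 1)
      + R (L (G ** w) (\<Delta> x)) (w ** G) + R (L (G ** w ** x') h) G"
    by (subst h) (simp add: action_bilinear action_assoc matrix_mul_assoc action_one)
  then show ?thesis
    by (simp only: 1 2) (simp add: action_assoc inverse action_one, simp add: h_def eq_neg_iff_add_eq_0 add.commute)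
qed

text \<open>
  The right-hand side of the preceding formula does not mention \<open>x\<close> except through \<open>e x e\<close>, which for
  \<open>e = rank_one v 1 u\<close> amounts to \<open>form u v x\<close>; so the same \<open>c\<close> and \<open>w\<close> serve for \<open>x\<close> and \<open>y\<close>.
\<close>

lemma form_determined:
  assumes uv: "(\<Sum>k\<in>UNIV. u k * v k) = 1" and xy: "form u v x = form u v y"
  shows "form u v (\<Delta> x) = form u v (\<Delta> y)"
proof -
  define e :: "'a ^ 'n ^ 'n" where "e = rank_one v 1 u"
  obtain c b where b: "(form u v x + c *\<^sub>C 1) * b = 1" "b * (form u v x + c *\<^sub>C 1) = 1"
    using shift_invertible by blast
  define G where "G = rank_one v (form u v x + c *\<^sub>C 1) u"
  define w where "w = rank_one v b u"
  have ee: "e ** e = e" by (simp add: e_def rank_one_mult uv scaleC_one)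
  have G: "e ** (z + c *\<^sub>C mat 1) ** e = G" if "form u v z = form u v x" for z
  proof -
    have "form u v (z + c *\<^sub>C mat 1) = form u v z + c *\<^sub>C 1"
      by (simp add: form_add_scaleC form_mat_one uv scaleC_one)
    then show ?thesis by (simp add: e_def rank_one_sandwich G_def that)
  qed
  have "R (L e (\<Delta> z)) e = - R (L G (\<Delta> w)) G" if "form u v z = form u v x" for z
    by (rule corner_formula[where c = c])
      (simp_all add: ee G that,
       simp_all add: e_def G_def w_def vanishes_on_rank_one rank_one_mult uv b scaleC_one)
  from this[of x] this[of y] have "R (L e (\<Delta> x)) e = R (L e (\<Delta> y)) e" using xy by simp
  then have eq: "rank_one v (form u v (\<Delta> x)) u = rank_one v (form u v (\<Delta> y)) u"
    by (simp add: e_def sandwich_rank_one)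
  obtain k where "u k * v k \<noteq> 0"
    using uv sum.neutral[of UNIV "\<lambda>k. u k * v k"] by fastforce
  then show ?thesis using rank_one_inj[OF eq, of k k] by (simp add: mult.commute)
qed

text \<open>
  Off the diagonal no idempotent of rank one isolates the entry \<open>(i, j)\<close>. Pairing \<open>dirac i\<close> or
  \<open>dirac j\<close> with \<open>dirac i + dirac j\<close> gives its sum with the entry \<open>(i, i)\<close> or \<open>(j, j)\<close>.
  The two resulting dependences are reconciled by an intermediate matrix that takes its
  \<open>(i, i)\<close> entry from \<open>x\<close> and its \<open>(j, j)\<close> entry from \<open>y\<close>.
\<close>

lemma entry_determined:
  assumes "x $ i $ j = y $ i $ j"
  shows "\<Delta> x $ i $ j = \<Delta> y $ i $ j"
proof -
  have diag: "\<Delta> x $ k $ k = \<Delta> y $ k $ k" if "x $ k $ k = y $ k $ k" for x y k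
    using form_determined[of "dirac k" "dirac k" x y] that
    by (simp add: form_dirac sum_dirac_complex) (simp add: dirac_def)
  show ?thesis
  proof (cases "i = j")
    case True
    then show ?thesis using diag assms by blast
  next
    case False
    have row: "\<Delta> x $ i $ j = \<Delta> y $ i $ j"
      if "x $ i $ i = y $ i $ i" "x $ i $ j = y $ i $ j" for x y
      using form_determined[of "dirac i" "\<lambda>k. dirac i k + dirac j k" x y] that diag[of x i y] False
      by (simp add: form_dirac_left sum_dirac_complex sum_two_dirac) (simp add: dirac_def)
    have col: "\<Delta> x $ i $ j = \<Delta> y $ i $ j"
      if "x $ j $ j = y $ j $ j" "x $ i $ j = y $ i $ j" for x y
      using form_determined[of "\<lambda>k. dirac i k + dirac j k" "dirac j" x y] that diag[of x j y] False
      by (simp add: form_dirac_right sum_dirac_complex sum_two_dirac distrib_right sum.distrib)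
        (simp add: dirac_def)
    define z :: "'a ^ 'n ^ 'n" where
      "z = (\<chi> p q. if p = i \<and> q = i then x $ i $ i else if p = j \<and> q = j then y $ j $ j else x $ i $ j)"
    have "\<Delta> x $ i $ j = \<Delta> z $ i $ j"
      using False by (intro row) (auto simp: z_def)
    also have "\<dots> = \<Delta> y $ i $ j"
      using False assms by (intro col) (auto simp: z_def)
    finally show ?thesis .
  qed
qed

text \<open>
  The relation says that \<open>x\<close> times the matrix with all columns \<open>v\<close> is zero, and \<open>\<Delta>\<close> vanishes at
  that matrix because it has rank one.
\<close>

lemma column_relation:
  assumes "\<And>p. (\<Sum>k\<in>UNIV. v k *\<^sub>C x $ p $ k) = 0"
  shows "(\<Sum>k\<in>UNIV. v k *\<^sub>C \<Delta> x $ p $ k) = 0"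
proof -
  define s :: "'a ^ 'n ^ 'n" where "s = rank_one v 1 (\<lambda>_. 1)"
  obtain D where D: "derivation (**) (matrix_bimodule l r) D" "D x = \<Delta> x" "D s = \<Delta> s"
    by (rule derivation_through)
  have "x ** s = 0"
    using assms by (simp add: vec_eq_iff matrix_matrix_mult_def s_def rank_one_def mult_scaleC_right)
  moreover have "D 0 = 0" using derivation_rules(2)[OF D(1), of 0 0] by simp
  ultimately have "R (\<Delta> x) s = 0"
    using derivation_rules(3)[OF D(1), of x s] by (simp add: D(2,3)) (simp add: s_def vanishes_on_rank_one)
  then have "R (\<Delta> x) s $ p $ p = 0" by simp
  then show ?thesis by (simp add: matrix_ract_def s_def rank_one_def coefficient_scalar)
qed

lemma row_relation:
  assumes "\<And>q. (\<Sum>k\<in>UNIV. u k *\<^sub>C x $ k $ q) = 0"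
  shows "(\<Sum>k\<in>UNIV. u k *\<^sub>C \<Delta> x $ k $ q) = 0"
proof -
  define s :: "'a ^ 'n ^ 'n" where "s = rank_one (\<lambda>_. 1) 1 u"
  obtain D where D: "derivation (**) (matrix_bimodule l r) D" "D x = \<Delta> x" "D s = \<Delta> s"
    by (rule derivation_through)
  have "s ** x = 0"
    using assms by (simp add: vec_eq_iff matrix_matrix_mult_def s_def rank_one_def mult_scaleC_left)
  moreover have "D 0 = 0" using derivation_rules(2)[OF D(1), of 0 0] by simp
  ultimately have "L s (\<Delta> x) = 0"
    using derivation_rules(3)[OF D(1), of s x] by (simp add: D(2,3)) (simp add: s_def vanishes_on_rank_one)
  then have "L s (\<Delta> x) $ q $ q = 0" by simp
  then show ?thesis by (simp add: matrix_lact_def s_def rank_one_def coefficient_scalar)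
qed

text \<open>
  By \<open>constant_matrix\<close> below, the position \<open>undefined\<close> is only one choice among equals.
\<close>

definition entry_map :: "'a \<Rightarrow> 'm" where
  "entry_map a = \<Delta> (\<chi> i j. a) $ undefined $ undefined"

lemma constant_matrix: "\<Delta> (\<chi> i j. a) $ i $ j = entry_map a"
proof -
  have 1: "\<Delta> (\<chi> i j. a) $ p $ q = \<Delta> (\<chi> i j. a) $ p $ q'" for p q q'
    using column_relation[of "\<lambda>k. dirac q k - dirac q' k" "\<chi> i j. a" p]
    by (simp add: scaleC.scale_left_diff_distrib sum_subtractf sum_dirac)
  have 2: "\<Delta> (\<chi> i j. a) $ p $ q = \<Delta> (\<chi> i j. a) $ p' $ q" for p p' q
    using row_relation[of "\<lambda>k. dirac p k - dirac p' k" "\<chi> i j. a" q]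
    by (simp add: scaleC.scale_left_diff_distrib sum_subtractf sum_dirac)
  show ?thesis unfolding entry_map_def using 1 2 by metis
qed

lemma entrywise: "\<Delta> x $ i $ j = entry_map (x $ i $ j)"
  using entry_determined[of x i j "\<chi> p q. x $ i $ j"] by (simp add: constant_matrix)

lemma entry_map_scaleC:
  assumes "CARD('n) \<ge> 2"
  shows "entry_map (c *\<^sub>C a) = c *\<^sub>C entry_map a"
proof -
  obtain T :: "'n set" where "card T = 2" using obtain_subset_with_card_n[OF assms] by blast
  then obtain i j :: 'n where ij: "i \<noteq> j" by (auto simp: card_2_iff)
  define x :: "'a ^ 'n ^ 'n" where "x = (\<chi> p q. if q = i then a else c *\<^sub>C a)"
  have "c *\<^sub>C \<Delta> x $ i $ i - \<Delta> x $ i $ j = 0"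
    using column_relation[of "\<lambda>k. c * dirac i k - dirac j k" x i] ij
    by (simp add: scaleC.scale_left_diff_distrib sum_subtractf sum_dirac sum_scaled_dirac x_def)
  then show ?thesis using ij by (simp add: entrywise x_def)
qed

lemma entry_map_add:
  assumes "CARD('n) \<ge> 3"
  shows "entry_map (a + b) = entry_map a + entry_map b"
proof -
  obtain T :: "'n set" where "card T = 3" using obtain_subset_with_card_n[OF assms] by blast
  then obtain i j k :: 'n where ijk: "i \<noteq> j" "i \<noteq> k" "j \<noteq> k" by (auto simp: card_3_iff)
  define x :: "'a ^ 'n ^ 'n" where "x = (\<chi> p q. if q = i then a else if q = j then b else a + b)"
  have "\<Delta> x $ i $ i + \<Delta> x $ i $ j - \<Delta> x $ i $ k = 0"
    using column_relation[of "\<lambda>q. dirac i q + dirac j q - dirac k q" x i] ijk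
    by (simp add: scaleC.scale_left_diff_distrib scaleC_add_left sum.distrib sum_subtractf sum_dirac x_def)
  then show ?thesis using ijk by (simp add: entrywise x_def)
qed

text \<open>
  Take a derivation that agrees with \<open>\<Delta>\<close> at the scalar matrix of \<open>a\<close> and at its square. As both are
  diagonal, a diagonal entry of the Leibniz rule involves only diagonal entries.
\<close>

lemma entry_map_square: "entry_map (a * a) = r (entry_map a) a + l a (entry_map a)"
proof -
  define x :: "'a ^ 'n ^ 'n" where "x = (\<chi> p q. if p = q then a else 0)"
  have if_mult: "(if p then y else 0) * z = (if p then y * z else 0)" for p and y z :: 'a by simp
  have act_if: "l (if p then y else 0) m = (if p then l y m else 0)"
    "r m (if p then y else 0) = (if p then r m y else 0)" for p y m
    by (simp_all add: coefficient_zero)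
  obtain D where D: "derivation (**) (matrix_bimodule l r) D" "D x = \<Delta> x" "D (x ** x) = \<Delta> (x ** x)"
    by (rule derivation_through)
  have "\<Delta> (x ** x) $ i $ i = R (\<Delta> x) x $ i $ i + L x (\<Delta> x) $ i $ i" for i
    using derivation_rules(3)[OF D(1), of x x] by (simp add: D(2,3))
  then show ?thesis
    by (simp add: entrywise matrix_lact_def matrix_ract_def x_def act_if if_mult matrix_matrix_mult_def)
qed

lemma normalized_is_derivation:
  assumes n: "CARD('n) \<ge> 3"
    and jordan: "\<And>(N :: ('a, 'a) bimodule) D.
      algebra_bimodule (*) N \<Longrightarrow> jordan_derivation (*) N D \<Longrightarrow> derivation (*) N D"
  shows "derivation (**) (matrix_bimodule l r) \<Delta>"
proof -
  have add: "entry_map (a + b) = entry_map a + entry_map b" for a b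
    using n by (rule entry_map_add)
  have scale: "entry_map (c *\<^sub>C a) = c *\<^sub>C entry_map a" for c a
    using n by (intro entry_map_scaleC) simp
  have "jordan_derivation (*) (type_bimodule l r) entry_map"
    by (simp add: jordan_derivation_def linear_into_def type_bimodule_def add scale entry_map_square)
  from jordan_derivation_hypothesis_transfer[OF jordan coefficient_bimodule this]
  have leibniz: "entry_map (a * b) = r (entry_map a) b + l a (entry_map b)" for a b
    by (simp add: derivation_def type_bimodule_def)
  interpret additive entry_map by standard (rule add)
  show ?thesis
    unfolding derivation_matrix_iff
    by (simp add: vec_eq_iff entrywise add scale scaleC_vec_def matrix_matrix_mult_def
        matrix_lact_def matrix_ract_def sum leibniz sum.distrib)
qed

end

section \<open>Reduction to the normalized case\<close>

theorem theorem2p1: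
  fixes l :: "'a::unital_complex_banach_algebra \<Rightarrow> 'm::complex_vector \<Rightarrow> 'm"
    and r :: "'m \<Rightarrow> 'a \<Rightarrow> 'm"
    and \<Delta> :: "'a ^ 'n ^ 'n \<Rightarrow> 'm ^ 'n ^ 'n"
  assumes "\<And>(N :: ('a, 'a) bimodule) D.
      algebra_bimodule (*) N \<Longrightarrow> jordan_derivation (*) N D \<Longrightarrow> derivation (*) N D"
    and "unital_bimodule (*) 1 (type_bimodule l r)"
    and "CARD('n) \<ge> 3"
    and "two_local_derivation (**) (matrix_bimodule l r) \<Delta>"
  shows "derivation (**) (matrix_bimodule l r) \<Delta>"
proof -
  interpret unital_coefficient_bimodule l r by standard (rule assms(2))
  define t :: "'n \<Rightarrow> complex" where "t i = of_nat (to_nat i)" for i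
  have t: "inj t" by (auto simp: inj_def t_def)
  define d :: "'a ^ 'n ^ 'n" where "d = (\<chi> i j. (if i = j then t i else 0) *\<^sub>C 1)"
  define J :: "'a ^ 'n ^ 'n" where "J = rank_one (\<lambda>_. 1) 1 (\<lambda>_. 1)"
  obtain D where D: "derivation (**) (matrix_bimodule l r) D" "D d = \<Delta> d" "D J = \<Delta> J"
    using assms(4) by (auto simp: two_local_derivation_def)
  interpret two_local l r "\<lambda>x. \<Delta> x - D x"
    by standard (rule two_local_derivation_diff[OF assms(4) D(1)])
  interpret normalized_two_local l r "\<lambda>x. \<Delta> x - D x"
    by standard (rule vanishes_on_units[OF t], use D in \<open>simp_all add: d_def J_def\<close>)
  have "derivation (**) (matrix_bimodule l r) (\<lambda>x. \<Delta> x - D x)"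
    using assms(3,1) by (rule normalized_is_derivation)
  from derivation_add[OF this D(1)] show ?thesis by simp
qed

end
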